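(* Let $\mathcal F$ be a free ultrafilter on $\omega$ that is not coherent to a $Q$-point. Then for any centered $\mathcal F_{\downarrow}$-Menger multicovered spaces $X$, $Y$ their semi-direct product $X\bowtie Y$ is $\mathcal F_{\downarrow}$-Menger.
   Context: A multicovered space is a pair $(X,\mu)$ consisting of a set $X$ and a family $\mu$ of covers of $X$ (its multicover). For a cover $u$ of $X$, a subset $B\subset X$ is $u$-bounded if $B\subset\bigcup u'$ for some finite subfamily $u'\subset u$. $(X,\mu)$ is centered if for any $u,v\in\mu$ there is $w\in\mu$ such that each $w$-bounded subset of $X$ is both $u$-bounded and $v$-bounded. For multicovered spaces $(X,\mu_X)$, $(Y,\mu_Y)$ put $\mu_X\ltimes\mu_Y=\{\{U\times V:U\in u,\ V\in v_U\}:u\in\mu_X,\ \{v_U\}_{U\in u}\subset\mu_Y\}$, $\mu_X\rtimes\mu_Y=\{\{U\times V:V\in v,\ U\in u_V\}:v\in\mu_Y,\ \{u_V\}_{V\in v}\subset\mu_X\}$, where $\{v_U\}_{U\in u}$ and $\{u_V\}_{V\in v}$ are arbitrary indexed families of covers. The meet of multicovers $\mu_0,\mu_1$ on one set is $\mu_0\wedge\mu_1=\{u\wedge v:u\in\mu_0,\ v\in\mu_1\}$, where $u\wedge v=\{U\cap V:U\in u,\ V\in v\}$. The semi-direct product is $X\bowtie Y=(X\times Y,\mu_X\bowtie\mu_Y)$ with $\mu_X\bowtie\mu_Y=(\mu_X\ltimes\mu_Y)\wedge(\mu_X\rtimes\mu_Y)$. A semifilter is a family $\mathcal F$ of infinite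 subsets of $\omega$ such that $A\in\mathcal F$, $B\subset\omega$ and $|A\setminus B|<\aleph_0$ imply $B\in\mathcal F$. Every free ultrafilter on $\omega$ is a semifilter. For a function $\varphi:\omega\to\omega$, $\varphi(\mathcal F)=\{\varphi(F):F\in\mathcal F\}$, and $\mathcal F_{\downarrow}=\{\varphi(\mathcal F):\varphi:\omega\to\omega\text{ is a monotone (nondecreasing) surjection}\}$, a family of semifilters. For a family $\mathsf F$ of semifilters, an indexed cover $\langle B_n\rangle_{n\in\omega}$ of $X$ is an $\mathsf F$-cover if there is $\mathcal H\in\mathsf F$ with $\{n\in\omega:x\in B_n\}\in\mathcal H$ for every $x\in X$. A multicovered space $(X,\mu)$ is $\mathsf F$-Menger if for each sequence $\langle u_n\rangle_{n\in\omega}\in\mu^\omega$ there is an $\mathsf F$-cover $\langle B_n\rangle_{n\in\omega}$ of $X$ by $u_n$-bounded subsets $B_n\subset X$. A multifunction $\Phi:\omega\Rightarrow\omega$ is a subset of $\omega\times\omega$, with $\Phi(n)=\{m:(n,m)\in\Phi\}$, $\Phi^{-1}=\{(n,m):(m,n)\in\Phi\}$, $\Phi(F)=\bigcup_{n\in F}\Phi(n)$; it is finite-to-finite if $\Phi(a)$ and $\Phi^{-1}(a)$ are finite and nonempty for every $a\in\omega$. Write $\mathcal F\Subset\mathcal U$ if there is a finite-to-finite multifunction $\Phi$ with $\{\Phi(F):F\in\mathcal F\}\subset\mathcal U$. Semifilters $\mathcal F,\mathcal U$ are coherent if $\mathcal F\Subset\mathcal U$ and $\mathcal U\Subset\mathcal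 F$. A $Q$-point is a free ultrafilter $\mathcal U$ on $\omega$ such that each finite-to-one function $f:\omega\to\omega$ (i.e. all $f^{-1}(y)$ are finite and nonempty) is injective on some $U\in\mathcal U$. *)

theory Defs
  imports Main
begin

definition covers :: "'a set set \<Rightarrow> 'a set \<Rightarrow> bool" where
  "covers u X \<longleftrightarrow> u \<subseteq> Pow X \<and> \<Union>u = X"

text \<open>A multicovered space is a carrier set together with a possibly empty family of covers of it.\<close>

definition multicovered :: "'a set \<Rightarrow> 'a set set set \<Rightarrow> bool" where
  "multicovered X \<mu> \<longleftrightarrow> (\<forall>u\<in>\<mu>. covers u X)"

definition cover_bounded :: "'a set set \<Rightarrow> 'a set \<Rightarrow> bool" where
  "cover_bounded u B \<longleftrightarrow> (\<exists>u'\<subseteq>u. finite u' \<and> B \<subseteq> \<Union>u')"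

definition centered :: "'a set \<Rightarrow> 'a set set set \<Rightarrow> bool" where
  "centered X \<mu> \<longleftrightarrow>
     (\<forall>u\<in>\<mu>. \<forall>v\<in>\<mu>. \<exists>w\<in>\<mu>. \<forall>B\<subseteq>X. cover_bounded w B \<longrightarrow> cover_bounded u B \<and> cover_bounded v B)"

text \<open>In the next two definitions an indexed family of covers is a total function of which only
  the values on the index cover matter.\<close>

definition left_product :: "'a set set set \<Rightarrow> 'b set set set \<Rightarrow> ('a \<times> 'b) set set set" where
  "left_product \<mu> \<nu> =
     {{U \<times> V |U V. U \<in> u \<and> V \<in> v U} |u v. u \<in> \<mu> \<and> (\<forall>U\<in>u. v U \<in> \<nu>)}"

definition right_product :: "'a set set set \<Rightarrow> 'b set set set \<Rightarrow> ('a \<times> 'b) set set set" where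
  "right_product \<mu> \<nu> =
     {{U \<times> V |U V. V \<in> v \<and> U \<in> u V} |u v. v \<in> \<nu> \<and> (\<forall>V\<in>v. u V \<in> \<mu>)}"

definition cover_meet :: "'a set set \<Rightarrow> 'a set set \<Rightarrow> 'a set set" where
  "cover_meet u v = {U \<inter> V |U V. U \<in> u \<and> V \<in> v}"

definition multicover_meet :: "'a set set set \<Rightarrow> 'a set set set \<Rightarrow> 'a set set set" where
  "multicover_meet \<mu> \<nu> = {cover_meet u v |u v. u \<in> \<mu> \<and> v \<in> \<nu>}"

definition semidirect :: "'a set set set \<Rightarrow> 'b set set set \<Rightarrow> ('a \<times> 'b) set set set" where
  "semidirect \<mu> \<nu> = multicover_meet (left_product \<mu> \<nu>) (right_product \<mu> \<nu>)"

lemma multicovered_semidirect: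
  assumes "multicovered X \<mu>" and "multicovered Y \<nu>"
  shows "multicovered (X \<times> Y) (semidirect \<mu> \<nu>)"
proof -
  have L: "multicovered (X \<times> Y) (left_product \<mu> \<nu>)"
    unfolding multicovered_def
  proof
    fix c assume "c \<in> left_product \<mu> \<nu>"
    then obtain u v where c: "c = {U \<times> V |U V. U \<in> u \<and> V \<in> v U}"
      and uv: "u \<in> \<mu>" "\<forall>U\<in>u. v U \<in> \<nu>"
      by (auto simp: left_product_def)
    have u: "covers u X" and v: "\<And>U. U \<in> u \<Longrightarrow> covers (v U) Y"
      using assms uv by (auto simp: multicovered_def)
    have "\<Union>c = (\<Union>U\<in>u. U \<times> \<Union>(v U))"
      unfolding c by blast
    also have "\<dots> = X \<times> Y"
      using u v by (auto simp: covers_def)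
    finally show "covers c (X \<times> Y)"
      unfolding covers_def by blast
  qed
  have R: "multicovered (X \<times> Y) (right_product \<mu> \<nu>)"
    unfolding multicovered_def
  proof
    fix c assume "c \<in> right_product \<mu> \<nu>"
    then obtain u v where c: "c = {U \<times> V |U V. V \<in> v \<and> U \<in> u V}"
      and uv: "v \<in> \<nu>" "\<forall>V\<in>v. u V \<in> \<mu>"
      by (auto simp: right_product_def)
    have v: "covers v Y" and u: "\<And>V. V \<in> v \<Longrightarrow> covers (u V) X"
      using assms uv by (auto simp: multicovered_def)
    have "\<Union>c = (\<Union>V\<in>v. \<Union>(u V) \<times> V)"
      unfolding c by blast
    also have "\<dots> = X \<times> Y"
      using u v by (auto simp: covers_def)
    finally show "covers c (X \<times> Y)"
      unfolding covers_def by blast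
  qed
  have "covers (cover_meet c d) (X \<times> Y)" if "covers c (X \<times> Y)" "covers d (X \<times> Y)" for c d
  proof -
    have "\<Union>(cover_meet c d) = \<Union>c \<inter> \<Union>d"
      unfolding cover_meet_def by blast
    then show ?thesis
      using that unfolding covers_def by blast
  qed
  with L R show ?thesis
    by (auto simp: multicovered_def semidirect_def multicover_meet_def)
qed

definition semifilter :: "nat set set \<Rightarrow> bool" where
  "semifilter F \<longleftrightarrow>
     (\<forall>A\<in>F. infinite A) \<and> (\<forall>A B. A \<in> F \<and> finite (A - B) \<longrightarrow> B \<in> F)"

definition free_ultrafilter :: "nat set set \<Rightarrow> bool" where
  "free_ultrafilter F \<longleftrightarrow>
     UNIV \<in> F \<and> {} \<notin> F \<and>
     (\<forall>A\<in>F. \<forall>B\<in>F. A \<inter> B \<in> F) \<and>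
     (\<forall>A\<in>F. \<forall>B. A \<subseteq> B \<longrightarrow> B \<in> F) \<and>
     (\<forall>A. A \<in> F \<or> - A \<in> F) \<and>
     \<Inter>F = {}"

lemma semifilter_free_ultrafilter:
  assumes "free_ultrafilter F"
  shows "semifilter F"
proof -
  have compl: "- {a} \<in> F" for a
  proof -
    obtain A where A: "A \<in> F" "a \<notin> A"
      using assms unfolding free_ultrafilter_def by blast
    then have "A \<subseteq> - {a}" by blast
    with A(1) show ?thesis
      using assms unfolding free_ultrafilter_def by blast
  qed
  have fin: "- A \<in> F" if "finite A" for A
    using that
  proof induction
    case empty
    show ?case using assms by (simp add: free_ultrafilter_def)
  next
    case (insert a A)
    have "- insert a A = - {a} \<inter> - A" by blast
    then show ?case
      using assms compl[of a] insert.IH unfolding free_ultrafilter_def by metis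
  qed
  have "infinite A" if "A \<in> F" for A
  proof
    assume "finite A"
    then have "A \<inter> - A \<in> F"
      using assms that fin unfolding free_ultrafilter_def by blast
    then show False
      using assms by (simp add: free_ultrafilter_def)
  qed
  moreover have "B \<in> F" if "A \<in> F" "finite (A - B)" for A B
  proof -
    have "A \<inter> - (A - B) \<in> F"
      using assms that fin unfolding free_ultrafilter_def by blast
    moreover have "A \<inter> - (A - B) \<subseteq> B" by blast
    ultimately show ?thesis
      using assms unfolding free_ultrafilter_def by blast
  qed
  ultimately show ?thesis
    by (auto simp: semifilter_def)
qed

definition monotone_images :: "nat set set \<Rightarrow> nat set set set" where
  "monotone_images F = {(`) \<phi> ` F |\<phi> :: nat \<Rightarrow> nat. mono \<phi> \<and> surj \<phi>}"

lemma semifilter_monotone_images: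
  assumes "semifilter F" and "H \<in> monotone_images F"
  shows "semifilter H"
proof -
  obtain \<phi> :: "nat \<Rightarrow> nat" where H: "H = (`) \<phi> ` F" and \<phi>: "mono \<phi>" "surj \<phi>"
    using assms(2) by (auto simp: monotone_images_def)
  have inf: "infinite A" if "A \<in> F" for A
    using assms(1) that unfolding semifilter_def by blast
  have up: "B \<in> F" if "A \<in> F" "finite (A - B)" for A B
    using assms(1) that unfolding semifilter_def by blast
  have fin: "finite (\<phi> -` {m})" for m
  proof -
    obtain k where k: "\<phi> k = Suc m"
      using \<phi>(2) by (metis surjD)
    have "n < k" if "\<phi> n = m" for n
    proof (rule ccontr)
      assume "\<not> n < k"
      then have "\<phi> k \<le> \<phi> n"
        using \<phi>(1) by (simp add: monoD)
      with k that show False by simp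
    qed
    then have "\<phi> -` {m} \<subseteq> {..<k}" by auto
    then show ?thesis
      by (rule finite_subset) simp
  qed
  have fin_vimage: "finite (\<phi> -` A)" if "finite A" for A
  proof -
    have "\<phi> -` A = (\<Union>m\<in>A. \<phi> -` {m})" by blast
    then show ?thesis using that fin by simp
  qed
  have inf': "infinite (\<phi> ` A)" if "A \<in> F" for A
  proof
    assume "finite (\<phi> ` A)"
    then have "finite (\<phi> -` (\<phi> ` A))"
      by (rule fin_vimage)
    moreover have "A \<subseteq> \<phi> -` (\<phi> ` A)" by auto
    ultimately have "finite A"
      by (rule rev_finite_subset)
    with inf[OF that] show False by contradiction
  qed
  have up': "B \<in> H" if "A \<in> F" "finite (\<phi> ` A - B)" for A B
  proof -
    have "A - \<phi> -` B \<subseteq> \<phi> -` (\<phi> ` A - B)" by auto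
    then have "finite (A - \<phi> -` B)"
      using fin_vimage[OF that(2)] by (rule finite_subset)
    with that(1) have "\<phi> -` B \<in> F"
      by (rule up)
    then have "\<phi> ` (\<phi> -` B) \<in> H"
      unfolding H by (rule imageI)
    then show ?thesis
      by (simp only: surj_image_vimage_eq[OF \<phi>(2)])
  qed
  show ?thesis
    unfolding semifilter_def
  proof (intro conjI ballI allI impI)
    fix C assume "C \<in> H"
    then obtain A where "A \<in> F" "C = \<phi> ` A" by (auto simp: H)
    with inf' show "infinite C" by simp
  next
    fix C B assume *: "C \<in> H \<and> finite (C - B)"
    then obtain A where "A \<in> F" "C = \<phi> ` A" by (auto simp: H)
    with * up'[of A B] show "B \<in> H" by simp
  qed
qed

definition semifilter_cover :: "nat set set set \<Rightarrow> 'a set \<Rightarrow> (nat \<Rightarrow> 'a set) \<Rightarrow> bool" where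
  "semifilter_cover FF X B \<longleftrightarrow>
     (\<Union>n. B n) = X \<and> (\<exists>H\<in>FF. \<forall>x\<in>X. {n. x \<in> B n} \<in> H)"

definition Menger :: "nat set set set \<Rightarrow> 'a set \<Rightarrow> 'a set set set \<Rightarrow> bool" where
  "Menger FF X \<mu> \<longleftrightarrow>
     (\<forall>u :: nat \<Rightarrow> 'a set set. (\<forall>n. u n \<in> \<mu>) \<longrightarrow>
        (\<exists>B. (\<forall>n. B n \<subseteq> X \<and> cover_bounded (u n) (B n)) \<and> semifilter_cover FF X B))"

text \<open>A multifunction on \<open>\<omega>\<close> is a relation \<open>\<Phi> :: nat rel\<close>, with \<open>\<Phi>(n) = \<Phi> `` {n}\<close>
  and \<open>\<Phi>(F) = \<Phi> `` F\<close>.\<close>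

definition finite_to_finite :: "nat rel \<Rightarrow> bool" where
  "finite_to_finite \<Phi> \<longleftrightarrow>
     (\<forall>a. finite (\<Phi> `` {a}) \<and> \<Phi> `` {a} \<noteq> {} \<and> finite (\<Phi>\<inverse> `` {a}) \<and> \<Phi>\<inverse> `` {a} \<noteq> {})"

definition subcoherent :: "nat set set \<Rightarrow> nat set set \<Rightarrow> bool" where
  "subcoherent F U \<longleftrightarrow> (\<exists>\<Phi>. finite_to_finite \<Phi> \<and> (\<lambda>A. \<Phi> `` A) ` F \<subseteq> U)"

definition coherent :: "nat set set \<Rightarrow> nat set set \<Rightarrow> bool" where
  "coherent F U \<longleftrightarrow> subcoherent F U \<and> subcoherent U F"

text \<open>The fibres are required to be nonempty, so finite-to-one functions are surjective.\<close>

definition finite_to_one :: "(nat \<Rightarrow> nat) \<Rightarrow> bool" where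
  "finite_to_one f \<longleftrightarrow> (\<forall>y. finite (f -` {y}) \<and> f -` {y} \<noteq> {})"

definition Q_point :: "nat set set \<Rightarrow> bool" where
  "Q_point U \<longleftrightarrow> free_ultrafilter U \<and> (\<forall>f. finite_to_one f \<longrightarrow> (\<exists>A\<in>U. inj_on f A))"

end

theory Submission
  imports Defs
begin

text \<open>Why the theorem holds. Consider first the left half \<open>\<mu> \<ltimes> \<nu>\<close>. Bounding a rectangle
  \<open>C \<times> D\<close> there is a two-step affair: a finite set of members of a cover of \<open>X\<close> is chosen to
  contain \<open>C\<close>, and only this choice determines for which covers of \<open>Y\<close> the set \<open>D\<close> has to be
  bounded. The Menger property of \<open>X\<close> gives sets \<open>C j\<close> together with a monotone surjection \<open>\<phi>\<close> such
  that \<open>x \<in> C (\<phi> n)\<close> for \<open>F\<close>-many \<open>n\<close>. For each \<open>k\<close> there is by centeredness a single cover of \<open>Y\<close>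
  that takes care of all requirements arising from \<open>C 0, \<dots>, C k\<close>, and the Menger property of \<open>Y\<close>,
  applied to these covers, gives sets \<open>D k\<close> and a second monotone surjection \<open>\<phi>'\<close>. The rectangle
  \<open>C j \<times> D k\<close> is then bounded with respect to the covers with index up to \<open>j\<close>, provided that
  \<open>j \<le> k\<close>. But \<open>\<phi>'\<close> is found after \<open>\<phi>\<close> and may grow much more slowly, so this proviso can fail for
  the rectangles \<open>C (\<phi> n) \<times> D (\<phi>' n)\<close>. The rectangles that can be used are those
  \<open>C (\<phi> n) \<times> D (\<phi>' n')\<close> in which \<open>n'\<close> is so much larger than \<open>n\<close> that \<open>\<phi> n \<le> \<phi>' n'\<close>.

  This is where the hypothesis on \<open>F\<close> enters. A monotone image of \<open>F\<close> is coherent to \<open>F\<close>, hence not a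
  Q-point. It follows that for every rate \<open>h\<close> of growth there is a monotone surjection \<open>\<psi>\<close>, as slow as
  desired, such that for every \<open>A \<in> F\<close> the fibre of \<open>\<psi>(F)\<close>-many \<open>m\<close> contains elements \<open>n\<close>, \<open>n'\<close> of
  \<open>A\<close> with \<open>h n \<le> n'\<close> (\<open>spread_pairs_in_fibres\<close>). Applied to the set \<open>A\<close> of all \<open>n\<close> with
  \<open>x \<in> C (\<phi> n)\<close> and \<open>y \<in> D (\<phi>' n)\<close>, this puts \<open>(x, y)\<close> into the union of the usable rectangles
  over the fibre of \<open>m\<close>, for \<open>\<psi>(F)\<close>-many \<open>m\<close>. The union is finite, and it is bounded with respect to
  the \<open>m\<close>-th cover because \<open>\<psi>\<close> is slower than \<open>\<phi>\<close>.

  The right half is the mirror image. The one-sided argument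
  (\<open>left_product_bounded_along_spread_pairs\<close>) produces a rate and a slowness and then works for every
  \<open>\<psi>\<close> that respects them, so one \<open>\<psi>\<close> can be chosen for both halves; intersecting the two sequences
  of sets gives the required cover by sets bounded with respect to the meets.\<close>

section \<open>Free ultrafilters and their monotone images\<close>

lemma free_ultrafilter_Int:
  "free_ultrafilter F \<Longrightarrow> A \<in> F \<Longrightarrow> B \<in> F \<Longrightarrow> A \<inter> B \<in> F"
  by (simp add: free_ultrafilter_def)

lemma free_ultrafilter_mono:
  "free_ultrafilter F \<Longrightarrow> A \<in> F \<Longrightarrow> A \<subseteq> B \<Longrightarrow> B \<in> F"
  by (simp add: free_ultrafilter_def)

lemma free_ultrafilter_Compl:
  "free_ultrafilter F \<Longrightarrow> A \<notin> F \<Longrightarrow> - A \<in> F"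
  unfolding free_ultrafilter_def by metis

lemma finite_fibre_mono_surj:
  fixes \<phi> :: "nat \<Rightarrow> nat"
  assumes "mono \<phi>" and "surj \<phi>"
  shows "finite (\<phi> -` {m})"
proof -
  obtain k where k: "\<phi> k = Suc m"
    using assms(2) by (metis surjD)
  have "\<phi> -` {m} \<subseteq> {..<k}"
  proof
    fix n assume "n \<in> \<phi> -` {m}"
    then have "\<not> \<phi> k \<le> \<phi> n" using k by simp
    then show "n \<in> {..<k}" using monoD[OF assms(1), of k n] by force
  qed
  then show ?thesis by (rule finite_subset) simp
qed

lemma mem_image_ultrafilter_iff:
  assumes "free_ultrafilter F" and "surj \<phi>"
  shows "B \<in> (`) \<phi> ` F \<longleftrightarrow> \<phi> -` B \<in> F"
proof
  assume "B \<in> (`) \<phi> ` F"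
  then obtain A where A: "A \<in> F" "B = \<phi> ` A" by (elim imageE)
  have "A \<subseteq> \<phi> -` B" unfolding A(2) by auto
  with A(1) show "\<phi> -` B \<in> F" by (rule free_ultrafilter_mono[OF assms(1)])
next
  assume "\<phi> -` B \<in> F"
  then have "\<phi> ` (\<phi> -` B) \<in> (`) \<phi> ` F" by (rule imageI)
  then show "B \<in> (`) \<phi> ` F" by (simp only: surj_image_vimage_eq[OF assms(2)])
qed

lemma free_ultrafilter_monotone_image:
  fixes \<phi> :: "nat \<Rightarrow> nat"
  assumes F: "free_ultrafilter F" and \<phi>: "mono \<phi>" "surj \<phi>"
  shows "free_ultrafilter ((`) \<phi> ` F)"
proof -
  note iff = mem_image_ultrafilter_iff[OF F \<phi>(2)]
  have "- {m} \<in> (`) \<phi> ` F" for m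
  proof -
    have "UNIV \<in> F" using F by (simp add: free_ultrafilter_def)
    moreover have "finite (UNIV - \<phi> -` (- {m}))"
      using finite_fibre_mono_surj[OF \<phi>, of m]
      by (simp add: vimage_Compl flip: Compl_eq_Diff_UNIV)
    ultimately have "\<phi> -` (- {m}) \<in> F"
      using semifilter_free_ultrafilter[OF F] unfolding semifilter_def by (metis (no_types))
    then show ?thesis by (simp only: iff)
  qed
  then have "m \<in> \<Inter> ((`) \<phi> ` F) \<Longrightarrow> m \<in> - {m}" for m by (rule InterD[rotated])
  then have notin: "m \<notin> \<Inter> ((`) \<phi> ` F)" for m by (metis ComplD singletonI)
  show ?thesis
    unfolding free_ultrafilter_def
  proof (intro conjI ballI allI impI)
    show "UNIV \<in> (`) \<phi> ` F" "{} \<notin> (`) \<phi> ` F"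
      using F unfolding iff free_ultrafilter_def by simp_all
    show "\<Inter> ((`) \<phi> ` F) = {}" by (rule equals0I) (use notin in metis)
  next
    fix A B assume "A \<in> (`) \<phi> ` F" "B \<in> (`) \<phi> ` F"
    then show "A \<inter> B \<in> (`) \<phi> ` F"
      unfolding iff vimage_Int by (rule free_ultrafilter_Int[OF F])
  next
    fix A B assume AB: "A \<in> (`) \<phi> ` F" "A \<subseteq> B"
    from AB(1) vimage_mono[OF AB(2), of \<phi>] show "B \<in> (`) \<phi> ` F"
      unfolding iff by (rule free_ultrafilter_mono[OF F])
  next
    fix A show "A \<in> (`) \<phi> ` F \<or> - A \<in> (`) \<phi> ` F"
      using free_ultrafilter_Compl[OF F, of "\<phi> -` A"] unfolding iff vimage_Compl by metis
  qed
qed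

text \<open>The graph of \<open>\<phi>\<close> and its converse witness the two directions of coherence: the first maps \<open>A\<close>
  to \<open>\<phi>(A)\<close>, the second maps \<open>\<phi>(A)\<close> to its saturation, which contains \<open>A\<close>.\<close>

lemma coherent_monotone_image:
  fixes \<phi> :: "nat \<Rightarrow> nat"
  assumes F: "free_ultrafilter F" and \<phi>: "mono \<phi>" "surj \<phi>"
  shows "coherent F ((`) \<phi> ` F)"
proof -
  define \<Phi> where "\<Phi> = {(n, \<phi> n) |n. True}"
  have img: "\<Phi> `` A = \<phi> ` A" for A by (auto simp: \<Phi>_def)
  have pre: "\<Phi>\<inverse> `` B = \<phi> -` B" for B by (auto simp: \<Phi>_def)
  have ne: "\<phi> -` {m} \<noteq> {}" for m
    using \<phi>(2) by (metis surjD vimage_singleton_eq empty_iff)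
  have fin: "finite_to_finite \<Phi>" "finite_to_finite (\<Phi>\<inverse>)"
    using finite_fibre_mono_surj[OF \<phi>] ne by (simp_all add: finite_to_finite_def img pre)
  have "subcoherent F ((`) \<phi> ` F)"
    unfolding subcoherent_def using fin(1)
    by (intro exI[of _ \<Phi>] conjI image_subsetI) (simp_all add: img)
  moreover have saturated: "\<Phi>\<inverse> `` B \<in> F" if "B \<in> (`) \<phi> ` F" for B
    using that unfolding pre mem_image_ultrafilter_iff[OF F \<phi>(2)] .
  have "subcoherent ((`) \<phi> ` F) F"
    unfolding subcoherent_def using fin(2) saturated
    by (intro exI[of _ "\<Phi>\<inverse>"] conjI image_subsetI) simp_all
  ultimately show ?thesis by (simp add: coherent_def)
qed

section \<open>Spread pairs in the fibres of a monotone surjection\<close>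

text \<open>The fibres of \<open>\<pi>\<close> are consecutive intervals, each so long that everything demanded by \<open>g\<close> from
  points before it is met at its end. Skipping one whole interval therefore suffices to go beyond
  \<open>g n\<close>. Making the intervals longer still slows \<open>\<pi>\<close> down below any given \<open>s\<close> that tends to
  infinity.\<close>

lemma slow_mono_surj_exists:
  fixes g s :: "nat \<Rightarrow> nat"
  assumes "\<forall>j. \<exists>t. \<forall>n\<ge>t. j \<le> s n"
  obtains \<pi> :: "nat \<Rightarrow> nat" where "mono \<pi>" and "surj \<pi>" and "\<And>n. \<pi> n \<le> s n"
    and "\<And>n n'. \<pi> n + 2 \<le> \<pi> n' \<Longrightarrow> g n \<le> n'"
proof -
  obtain t where t: "\<And>j n. t j \<le> n \<Longrightarrow> j \<le> s n"
    using assms by metis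
  define k where "k = rec_nat 0 (\<lambda>i ki. Suc (ki + (\<Sum>n\<le>ki. g n) + t (Suc i)))"
  have k0: "k 0 = 0" and kS: "\<And>i. k (Suc i) = Suc (k i + (\<Sum>n\<le>k i. g n) + t (Suc i))"
    by (simp_all add: k_def)
  have "strict_mono k"
    by (simp add: strict_mono_Suc_iff kS)
  then have le_iff: "k i \<le> k j \<longleftrightarrow> i \<le> j" and less_iff: "k i < k j \<longleftrightarrow> i < j" for i j
    by (simp_all add: strict_mono_less_eq strict_mono_less)
  \<comment> \<open>\<open>\<pi>\<close> maps the interval \<open>{k i..<k (Suc i)}\<close> to \<open>i\<close>.\<close>
  define \<pi> where "\<pi> n = (LEAST i. n < k (Suc i))" for n
  have ex: "\<exists>i. n < k (Suc i)" for n
    using strict_mono_imp_increasing[OF \<open>strict_mono k\<close>, of "Suc n"] by (auto simp: Suc_le_eq)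
  have upper: "n < k (Suc (\<pi> n))" for n
    unfolding \<pi>_def using ex by (rule LeastI_ex)
  have lower: "k (\<pi> n) \<le> n" for n
  proof (cases "\<pi> n")
    case (Suc i)
    then have "\<not> n < k (Suc i)" unfolding \<pi>_def by (intro not_less_Least) simp
    with Suc show ?thesis by simp
  qed (simp add: k0)
  have mono: "mono \<pi>"
  proof (rule monoI)
    fix m n :: nat assume "m \<le> n"
    then have "k (\<pi> m) < k (Suc (\<pi> n))" using lower[of m] upper[of n] by linarith
    then show "\<pi> m \<le> \<pi> n" by (simp add: less_iff)
  qed
  have "\<pi> (k i) = i" for i
    using lower[of "k i"] upper[of "k i"] by (simp add: le_iff less_iff)
  then have surj: "surj \<pi>" by (rule surjI)
  have slow: "\<pi> n \<le> s n" for n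
  proof (cases "\<pi> n")
    case (Suc i)
    then have "t (\<pi> n) \<le> n" using lower[of n] by (simp add: kS)
    then show ?thesis by (rule t)
  qed simp
  have "g n \<le> n'" if "\<pi> n + 2 \<le> \<pi> n'" for n n'
  proof -
    have "g n \<le> (\<Sum>n\<le>k (Suc (\<pi> n)). g n)"
      using upper[of n] by (intro member_le_sum) auto
    also have "\<dots> \<le> k (Suc (Suc (\<pi> n)))" by (simp add: kS[of "Suc (\<pi> n)"])
    also have "\<dots> \<le> k (\<pi> n')" using that by (simp add: le_iff)
    also have "\<dots> \<le> n'" by (rule lower)
    finally show ?thesis .
  qed
  with mono surj slow show thesis by (rule that)
qed

text \<open>A finite-to-one function that is injective on no element of \<open>G\<close> can be replaced by a monotone
  one. Cut \<open>\<omega>\<close> into intervals such that each fibre of \<open>f\<close> lies within two adjacent ones. Two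
  adjacent intervals are merged either by pairing each even interval with its successor or by
  pairing it with its predecessor, and two points in one fibre of \<open>f\<close> are merged by at least one of the
  pairings. If each pairing were injective on some element of \<open>G\<close>, then \<open>f\<close> would be injective on the
  intersection of these two elements.\<close>

lemma not_Q_point_mono_surj:
  assumes G: "free_ultrafilter G" and "\<not> Q_point G"
  obtains \<rho> :: "nat \<Rightarrow> nat" where "mono \<rho>" and "surj \<rho>" and "\<And>A. A \<in> G \<Longrightarrow> \<not> inj_on \<rho> A"
proof -
  obtain f where f: "finite_to_one f" and noninj: "\<And>A. A \<in> G \<Longrightarrow> \<not> inj_on f A"
    using assms unfolding Q_point_def by metis
  define g where "g n = Suc (Max (f -` {f n}))" for n
  have less_g: "n' < g n" if "f n = f n'" for n n'
    using f that by (simp add: g_def finite_to_one_def less_Suc_eq_le)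
  obtain \<pi> :: "nat \<Rightarrow> nat" where \<pi>: "mono \<pi>" "surj \<pi>"
    and gap: "\<And>n n'. \<pi> n + 2 \<le> \<pi> n' \<Longrightarrow> g n \<le> n'"
  proof (rule slow_mono_surj_exists[of "\<lambda>n. n" g])
    show "\<forall>j. \<exists>t. \<forall>n\<ge>t. j \<le> n" by auto
  qed (rule that)
  have close: "\<pi> n' \<le> \<pi> n + 1" if "f n = f n'" for n n'
    using less_g[OF that] gap[of n n'] by linarith
  define \<rho> where "\<rho> e n = (\<pi> n + e) div 2" for e n :: nat
  have mono: "mono (\<rho> e)" for e
    using monoD[OF \<pi>(1)] by (intro monoI) (simp add: \<rho>_def div_le_mono)
  have surj: "surj (\<rho> e)" if "e \<le> 1" for e
  proof -
    obtain r where r: "\<And>m. \<pi> (r m) = m" using \<pi>(2) by (metis surjD)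
    have "\<rho> e (r (2 * m)) = m" for m
      using that by (simp add: \<rho>_def r)
    then show ?thesis by (rule surjI)
  qed
  have "(\<forall>A\<in>G. \<not> inj_on (\<rho> 0) A) \<or> (\<forall>A\<in>G. \<not> inj_on (\<rho> 1) A)"
  proof (rule ccontr)
    assume "\<not> ?thesis"
    then obtain A A' where A: "A \<in> G" "A' \<in> G" and inj: "inj_on (\<rho> 0) A" "inj_on (\<rho> 1) A'"
      unfolding de_Morgan_disj Set.ball_simps not_not by (elim conjE bexE)
    have "inj_on f (A \<inter> A')"
    proof (rule inj_onI)
      fix n n' assume nn: "n \<in> A \<inter> A'" "n' \<in> A \<inter> A'" and "f n = f n'"
      have "\<pi> n' \<le> \<pi> n + 1" "\<pi> n \<le> \<pi> n' + 1"
        using \<open>f n = f n'\<close> by (rule close, rule close[OF sym])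
      then have "\<pi> n div 2 = \<pi> n' div 2 \<or> (\<pi> n + 1) div 2 = (\<pi> n' + 1) div 2"
        by (cases "even (\<pi> n)"; cases "even (\<pi> n')") (auto elim!: evenE oddE)
      then have "\<rho> 0 n = \<rho> 0 n' \<or> \<rho> 1 n = \<rho> 1 n'" by (simp add: \<rho>_def)
      with inj nn show "n = n'" by (metis IntE inj_onD)
    qed
    with noninj[OF free_ultrafilter_Int[OF G A]] show False ..
  qed
  then show thesis
  proof
    assume "\<forall>A\<in>G. \<not> inj_on (\<rho> 0) A"
    then show thesis by (intro that[OF mono surj[of 0]]) simp_all
  next
    assume "\<forall>A\<in>G. \<not> inj_on (\<rho> 1) A"
    then show thesis by (intro that[OF mono surj[of 1]]) simp_all
  qed
qed

text \<open>The combinatorial content of the hypothesis on \<open>F\<close>. Group \<open>\<omega>\<close> by a slow \<open>\<pi>\<close> for which points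
  in distinct non-adjacent fibres are spread with respect to \<open>h\<close>, and group the fibres of \<open>\<pi>\<close> further by a
  \<open>\<rho>\<close> that is injective on no element of the ultrafilter \<open>\<pi>(F)\<close>. If \<open>A \<in> F\<close> had no spread pairs in
  the fibres of \<open>\<rho> \<circ> \<pi>\<close>, then after thinning \<open>A\<close> out to one parity of \<open>\<pi>\<close>, so that distinct fibres
  of \<open>\<pi>\<close> meeting it are never adjacent, \<open>\<rho>\<close> would be injective on \<open>\<pi>(A)\<close>.\<close>

lemma spread_pairs_in_fibres:
  fixes h s :: "nat \<Rightarrow> nat"
  assumes F: "free_ultrafilter F" and noQ: "\<not> (\<exists>U. Q_point U \<and> coherent F U)"
    and s: "\<forall>j. \<exists>t. \<forall>n\<ge>t. j \<le> s n"
  obtains \<psi> :: "nat \<Rightarrow> nat" where "mono \<psi>" and "surj \<psi>" and "\<And>n. \<psi> n \<le> s n"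
    and "\<And>A. A \<in> F \<Longrightarrow>
      {m. \<exists>n\<in>A. \<exists>n'\<in>A. \<psi> n = m \<and> \<psi> n' = m \<and> h n \<le> n'} \<in> (`) \<psi> ` F"
proof -
  obtain \<pi> :: "nat \<Rightarrow> nat" where \<pi>: "mono \<pi>" "surj \<pi>" and slow: "\<And>n. \<pi> n \<le> s n"
    and gap: "\<And>n n'. \<pi> n + 2 \<le> \<pi> n' \<Longrightarrow> h n \<le> n'"
    using slow_mono_surj_exists[OF s, of h] by blast
  define G where "G = (`) \<pi> ` F"
  have "free_ultrafilter G" "\<not> Q_point G"
    using free_ultrafilter_monotone_image[OF F \<pi>] coherent_monotone_image[OF F \<pi>] noQ
    unfolding G_def by blast+
  then obtain \<rho> :: "nat \<Rightarrow> nat" where \<rho>: "mono \<rho>" "surj \<rho>"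
    and noninj: "\<And>A. A \<in> G \<Longrightarrow> \<not> inj_on \<rho> A"
    by (rule not_Q_point_mono_surj) blast
  define \<psi> where "\<psi> = \<rho> \<circ> \<pi>"
  have mono: "mono \<psi>" and surj: "surj \<psi>"
    unfolding \<psi>_def using monotone_on_o[OF \<rho>(1) \<pi>(1)] comp_surj[OF \<pi>(2) \<rho>(2)] by simp_all
  have "\<rho> n \<le> n" for n
  proof (induction n)
    case 0
    obtain k where "\<rho> k = 0" using \<rho>(2) by (metis surjD)
    then show ?case using monoD[OF \<rho>(1), of 0 k] by simp
  next
    case (Suc n)
    \<comment> \<open>A monotone surjection cannot skip the value \<open>Suc (\<rho> n)\<close>.\<close>
    obtain k where k: "\<rho> k = Suc (\<rho> n)" using \<rho>(2) by (metis surjD)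
    then have "Suc n \<le> k" using monoD[OF \<rho>(1), of k n] by (metis Suc_n_not_le_n not_less_eq_eq)
    then have "\<rho> (Suc n) \<le> Suc (\<rho> n)" using monoD[OF \<rho>(1), of "Suc n" k] k by simp
    with Suc show ?case by simp
  qed
  then have slow': "\<psi> n \<le> s n" for n
    using slow[of n] unfolding \<psi>_def comp_def by (rule order_trans)
  have "{m. \<exists>n\<in>A. \<exists>n'\<in>A. \<psi> n = m \<and> \<psi> n' = m \<and> h n \<le> n'} \<in> (`) \<psi> ` F" (is "?M \<in> _")
    if A: "A \<in> F" for A
  proof (rule ccontr)
    assume "?M \<notin> (`) \<psi> ` F"
    then have nM: "- (\<psi> -` ?M) \<in> F"
      unfolding mem_image_ultrafilter_iff[OF F surj] by (rule free_ultrafilter_Compl[OF F])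
    obtain P where P: "P \<in> F" "\<And>n n'. n \<in> P \<Longrightarrow> n' \<in> P \<Longrightarrow> even (\<pi> n) = even (\<pi> n')"
    proof (cases "{n. even (\<pi> n)} \<in> F")
      case True
      then show ?thesis by (rule that) simp
    next
      case False
      from free_ultrafilter_Compl[OF F this] show ?thesis by (rule that) simp
    qed
    define A' where "A' = A \<inter> - (\<psi> -` ?M) \<inter> P"
    have "A' \<in> F"
      unfolding A'_def using A nM P(1) by (intro free_ultrafilter_Int[OF F])
    have no_less: "\<not> \<pi> n < \<pi> n'" if "n \<in> A'" "n' \<in> A'" "\<psi> n = \<psi> n'" for n n'
    proof
      assume "\<pi> n < \<pi> n'"
      moreover have "even (\<pi> n) = even (\<pi> n')" using that P(2) by (simp add: A'_def)
      ultimately have "\<pi> n + 2 \<le> \<pi> n'" by presburger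
      then have "h n \<le> n'" by (rule gap)
      moreover have "n \<in> A" "n' \<in> A" using that by (simp_all add: A'_def)
      ultimately have "\<psi> n \<in> ?M" using that(3) by (intro CollectI bexI[of _ n] bexI[of _ n']) auto
      then show False using that(1) by (simp only: A'_def Int_iff Compl_iff vimage_eq simp_thms)
    qed
    have "inj_on \<rho> (\<pi> ` A')"
    proof (rule inj_onI, elim imageE)
      fix a b n n' assume "\<rho> a = \<rho> b" "a = \<pi> n" "n \<in> A'" "b = \<pi> n'" "n' \<in> A'"
      with no_less[of n n'] no_less[of n' n] show "a = b" by (simp add: \<psi>_def)
    qed
    moreover have "\<pi> ` A' \<in> G" unfolding G_def using \<open>A' \<in> F\<close> by (rule imageI)
    ultimately show False using noninj by blast
  qed
  with mono surj slow' show thesis by (rule that)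
qed

section \<open>Bounded sets\<close>

lemma cover_boundedI:
  "u' \<subseteq> u \<Longrightarrow> finite u' \<Longrightarrow> B \<subseteq> \<Union>u' \<Longrightarrow> cover_bounded u B"
  unfolding cover_bounded_def by (intro exI[of _ u']) simp

lemma cover_bounded_UN:
  assumes "finite I" and "\<And>i. i \<in> I \<Longrightarrow> cover_bounded u (B i)"
  shows "cover_bounded u (\<Union>i\<in>I. B i)"
proof -
  obtain w where w: "\<And>i. i \<in> I \<Longrightarrow> w i \<subseteq> u \<and> finite (w i) \<and> B i \<subseteq> \<Union> (w i)"
    using assms(2) unfolding cover_bounded_def by metis
  show ?thesis
  proof (rule cover_boundedI)
    show "(\<Union>i\<in>I. w i) \<subseteq> u" using w by (intro UN_least) simp
    show "finite (\<Union>i\<in>I. w i)" using assms(1) w by simp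
    show "(\<Union>i\<in>I. B i) \<subseteq> \<Union> (\<Union>i\<in>I. w i)"
    proof (rule UN_least)
      fix i assume "i \<in> I"
      then have "B i \<subseteq> \<Union> (w i)" "w i \<subseteq> (\<Union>i\<in>I. w i)" using w by auto
      then show "B i \<subseteq> \<Union> (\<Union>i\<in>I. w i)" by (meson Union_mono order_trans)
    qed
  qed
qed

lemma cover_bounded_meet:
  assumes "cover_bounded c A" and "cover_bounded d B"
  shows "cover_bounded (cover_meet c d) (A \<inter> B)"
proof -
  obtain c' d' where cd: "c' \<subseteq> c" "finite c'" "A \<subseteq> \<Union>c'" "d' \<subseteq> d" "finite d'" "B \<subseteq> \<Union>d'"
    using assms unfolding cover_bounded_def by blast
  let ?w = "(\<lambda>(U, V). U \<inter> V) ` (c' \<times> d')"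
  have "?w \<subseteq> cover_meet c d" "finite ?w" "A \<inter> B \<subseteq> \<Union>?w"
    using cd by (auto 0 3 simp: cover_meet_def)
  then show ?thesis by (rule cover_boundedI)
qed

lemma cover_bounded_image:
  assumes "cover_bounded c E"
  shows "cover_bounded ((`) f ` c) (f ` E)"
proof -
  obtain c' where c': "c' \<subseteq> c" "finite c'" "E \<subseteq> \<Union>c'"
    using assms unfolding cover_bounded_def by blast
  show ?thesis
  proof (rule cover_boundedI)
    show "(`) f ` c' \<subseteq> (`) f ` c" using c'(1) by (rule image_mono)
    show "finite ((`) f ` c')" using c'(2) by (rule finite_imageI)
    show "f ` E \<subseteq> \<Union> ((`) f ` c')" using image_mono[OF c'(3), of f] by (simp only: image_Union)
  qed
qed

lemma cover_bounded_rectangle: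
  assumes K: "K \<subseteq> u" "finite K" "C \<subseteq> \<Union>K" and D: "\<And>U. U \<in> K \<Longrightarrow> cover_bounded (v U) D"
  shows "cover_bounded {U \<times> V |U V. U \<in> u \<and> V \<in> v U} (C \<times> D)"
proof -
  obtain w where w: "\<And>U. U \<in> K \<Longrightarrow> w U \<subseteq> v U \<and> finite (w U) \<and> D \<subseteq> \<Union> (w U)"
    using D unfolding cover_bounded_def by metis
  let ?r = "\<Union>U\<in>K. (\<lambda>V. U \<times> V) ` w U"
  have "?r \<subseteq> {U \<times> V |U V. U \<in> u \<and> V \<in> v U}"
  proof clarify
    fix U V assume "U \<in> K" "V \<in> w U"
    then have "U \<in> u" "V \<in> v U" using K(1) w[of U] by blast+
    then show "\<exists>U' V'. U \<times> V = U' \<times> V' \<and> U' \<in> u \<and> V' \<in> v U'" by blast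
  qed
  moreover have "finite ?r" using K(2) w by auto
  moreover have "C \<times> D \<subseteq> \<Union>?r"
  proof clarify
    fix x y assume "x \<in> C" "y \<in> D"
    then obtain U where U: "U \<in> K" "x \<in> U" using K(3) by blast
    obtain V where "V \<in> w U" "y \<in> V" using w[OF U(1)] \<open>y \<in> D\<close> by blast
    with U show "(x, y) \<in> \<Union>?r" by blast
  qed
  ultimately show ?thesis by (rule cover_boundedI)
qed

lemma centered_finite:
  assumes "centered X \<mu>" and "\<mu> \<noteq> {}" and "finite S" and "S \<subseteq> \<mu>"
  shows "\<exists>w\<in>\<mu>. \<forall>B\<subseteq>X. cover_bounded w B \<longrightarrow> (\<forall>u\<in>S. cover_bounded u B)"
  using assms(3,4)
proof induction
  case empty
  then show ?case using assms(2) by blast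
next
  case (insert u S)
  then have "\<exists>w\<in>\<mu>. \<forall>B\<subseteq>X. cover_bounded w B \<longrightarrow> (\<forall>u\<in>S. cover_bounded u B)"
    by simp
  then obtain w where w: "w \<in> \<mu>"
    "\<forall>B\<subseteq>X. cover_bounded w B \<longrightarrow> (\<forall>u\<in>S. cover_bounded u B)"
    by (rule bexE)
  obtain w' where w': "w' \<in> \<mu>"
    "\<forall>B\<subseteq>X. cover_bounded w' B \<longrightarrow> cover_bounded w B \<and> cover_bounded u B"
    using assms(1) w(1) insert.prems unfolding centered_def by (meson insert_subset)
  show ?case
  proof (intro bexI[OF _ w'(1)] allI impI)
    fix B assume B: "B \<subseteq> X" "cover_bounded w' B"
    then have "cover_bounded w B" "cover_bounded u B" using w'(2) by blast+
    moreover from this(1) B(1) have "\<forall>z\<in>S. cover_bounded z B" using w(2) by blast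
    ultimately show "\<forall>z\<in>insert u S. cover_bounded z B" by simp
  qed
qed

section \<open>Menger sequences for the two halves of the semi-direct product\<close>

lemma Menger_along_ultrafilter:
  assumes F: "free_ultrafilter F" and "Menger (monotone_images F) X \<mu>" and "\<And>n. u n \<in> \<mu>"
  obtains B and \<phi> :: "nat \<Rightarrow> nat" where "\<And>n. B n \<subseteq> X" and "\<And>n. cover_bounded (u n) (B n)"
    and "mono \<phi>" and "surj \<phi>" and "\<And>x. x \<in> X \<Longrightarrow> {n. x \<in> B (\<phi> n)} \<in> F"
proof -
  obtain B where B: "\<And>n. B n \<subseteq> X" "\<And>n. cover_bounded (u n) (B n)"
    and "semifilter_cover (monotone_images F) X B"
    using assms(2,3) unfolding Menger_def by meson
  then obtain \<phi> :: "nat \<Rightarrow> nat" where \<phi>: "mono \<phi>" "surj \<phi>"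
    and "\<forall>x\<in>X. {n. x \<in> B n} \<in> (`) \<phi> ` F"
    unfolding semifilter_cover_def monotone_images_def by blast
  then have "{n. x \<in> B (\<phi> n)} \<in> F" if "x \<in> X" for x
    using that mem_image_ultrafilter_iff[OF F \<phi>(2), of "{n. x \<in> B n}"] by (simp add: vimage_def)
  with B \<phi> show thesis by (rule that)
qed

text \<open>A weak form of covering, stated for any \<open>\<psi>\<close>: every point \<open>p\<close> has its own \<open>A \<in> F\<close>, and the set
  \<open>E m\<close> has to contain \<open>p\<close> only if the fibre of \<open>m\<close> contains elements \<open>n\<close>, \<open>n'\<close> of \<open>A\<close> with
  \<open>h n \<le> n'\<close>. If all \<open>A \<in> F\<close> have such pairs in \<open>\<psi>(F)\<close>-many fibres, it is a covering along
  \<open>\<psi>(F)\<close>.\<close>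

definition bounded_along_spread_pairs ::
    "nat set set \<Rightarrow> 'p set \<Rightarrow> (nat \<Rightarrow> 'p set set) \<Rightarrow> (nat \<Rightarrow> nat) \<Rightarrow> (nat \<Rightarrow> nat) \<Rightarrow> bool" where
  "bounded_along_spread_pairs F Z c h \<psi> \<longleftrightarrow>
     (\<exists>E. (\<forall>m. E m \<subseteq> Z \<and> cover_bounded (c m) (E m)) \<and>
       (\<forall>p\<in>Z. \<exists>A\<in>F. \<forall>n\<in>A. \<forall>n'\<in>A. \<psi> n = \<psi> n' \<and> h n \<le> n' \<longrightarrow> p \<in> E (\<psi> n)))"

text \<open>The covers of \<open>Y\<close> are chosen after the sets \<open>C j\<close>, so that the rectangle \<open>C j \<times> D k\<close> is bounded
  with respect to \<open>c m\<close> whenever \<open>m \<le> j \<le> k\<close>. For \<open>j = \<phi> n\<close> and \<open>k = \<phi>' n'\<close> the inequality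
  \<open>j \<le> k\<close> is what \<open>h n \<le> n'\<close> guarantees, and \<open>m \<le> j\<close> follows on the fibre of \<open>m\<close> from \<open>\<psi> \<le> s\<close>, where
  \<open>s = \<phi>\<close>.\<close>

lemma left_product_bounded_along_spread_pairs:
  assumes F: "free_ultrafilter F"
    and X: "centered (X :: 'a set) \<mu>" "Menger (monotone_images F) X \<mu>"
    and Y: "centered (Y :: 'b set) \<nu>" "Menger (monotone_images F) Y \<nu>" "\<nu> \<noteq> {}"
    and c: "\<And>n. c n \<in> left_product \<mu> \<nu>"
  shows "\<exists>h s. (\<forall>j. \<exists>t. \<forall>n\<ge>t. j \<le> s n) \<and>
    (\<forall>\<psi>. mono \<psi> \<and> surj \<psi> \<and> (\<forall>n. \<psi> n \<le> s n) \<longrightarrow> bounded_along_spread_pairs F (X \<times> Y) c h \<psi>)"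
proof -
  define rects where "rects u v = {U \<times> V |U V. U \<in> u \<and> V \<in> v U}"
    for u :: "'a set set" and v :: "'a set \<Rightarrow> 'b set set"
  have "\<exists>u v. c n = rects u v \<and> u \<in> \<mu> \<and> (\<forall>U\<in>u. v U \<in> \<nu>)" for n
    using c[of n] by (simp only: left_product_def mem_Collect_eq rects_def)
  then obtain u v where c_eq: "\<And>n. c n = rects (u n) (v n)"
    and u: "\<And>n. u n \<in> \<mu>" and v: "\<And>n U. U \<in> u n \<Longrightarrow> v n U \<in> \<nu>"
    by metis
  have "\<exists>w\<in>\<mu>. \<forall>B\<subseteq>X. cover_bounded w B \<longrightarrow> (\<forall>u\<in>u ` {..j}. cover_bounded u B)" for j
  proof (rule centered_finite[OF X(1)])
    show "\<mu> \<noteq> {}" using u[of 0] by (metis empty_iff)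
    show "u ` {..j} \<subseteq> \<mu>" using u by (intro image_subsetI)
  qed simp
  then obtain a where a: "\<And>j. a j \<in> \<mu>"
    and a_bdd: "\<And>j m B. B \<subseteq> X \<Longrightarrow> cover_bounded (a j) B \<Longrightarrow> m \<le> j \<Longrightarrow> cover_bounded (u m) B"
    by (metis atMost_iff imageI)
  obtain C and \<phi> :: "nat \<Rightarrow> nat" where C: "\<And>j. C j \<subseteq> X" "\<And>j. cover_bounded (a j) (C j)"
    and \<phi>: "mono \<phi>" "surj \<phi>" and C_cov: "\<And>x. x \<in> X \<Longrightarrow> {n. x \<in> C (\<phi> n)} \<in> F"
    by (rule Menger_along_ultrafilter[OF F X(2), of a, OF a]) (rule that)
  have "\<forall>j m. \<exists>K. m \<le> j \<longrightarrow> K \<subseteq> u m \<and> finite K \<and> C j \<subseteq> \<Union>K"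
    using a_bdd[OF C] unfolding cover_bounded_def by metis
  then obtain K where
    K: "\<And>j m. m \<le> j \<Longrightarrow> K j m \<subseteq> u m \<and> finite (K j m) \<and> C j \<subseteq> \<Union> (K j m)"
    by metis
  define W where "W k = (\<Union>j\<le>k. \<Union>m\<le>j. v m ` K j m)" for k
  have "\<exists>w\<in>\<nu>. \<forall>B\<subseteq>Y. cover_bounded w B \<longrightarrow> (\<forall>z\<in>W k. cover_bounded z B)" for k
  proof (rule centered_finite[OF Y(1,3)])
    show "finite (W k)" unfolding W_def using K by simp
    show "W k \<subseteq> \<nu>"
      unfolding W_def
    proof (intro UN_least image_subsetI)
      fix j m U assume "m \<in> {..j}" "U \<in> K j m"
      then have "U \<in> u m" using K[of m j] by (simp add: subset_iff)
      then show "v m U \<in> \<nu>" by (rule v)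
    qed
  qed
  then obtain d where d: "\<And>k. d k \<in> \<nu>"
    and d_bdd': "\<And>k B. B \<subseteq> Y \<Longrightarrow> cover_bounded (d k) B \<Longrightarrow>
      \<forall>z\<in>W k. cover_bounded z B"
    by metis
  have d_bdd: "cover_bounded (v m U) B"
    if "B \<subseteq> Y" "cover_bounded (d k) B" "m \<le> j" "j \<le> k" "U \<in> K j m" for k B m j U
  proof -
    have "v m U \<in> W k"
      unfolding W_def using that(3-5) by (intro UN_I[of j] UN_I[of m] imageI) simp_all
    with d_bdd'[OF that(1,2)] show ?thesis by (rule bspec)
  qed
  obtain D and \<phi>' :: "nat \<Rightarrow> nat" where D: "\<And>k. D k \<subseteq> Y" "\<And>k. cover_bounded (d k) (D k)"
    and \<phi>': "mono \<phi>'" "surj \<phi>'" and D_cov: "\<And>y. y \<in> Y \<Longrightarrow> {n. y \<in> D (\<phi>' n)} \<in> F"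
    by (rule Menger_along_ultrafilter[OF F Y(2), of d, OF d]) (rule that)
  have rectangle: "cover_bounded (c m) (C j \<times> D k)" if "m \<le> j" "j \<le> k" for m j k
    unfolding c_eq rects_def
  proof (rule cover_bounded_rectangle)
    show "K j m \<subseteq> u m" "finite (K j m)" "C j \<subseteq> \<Union> (K j m)" using K[OF that(1)] by simp_all
    show "cover_bounded (v m U) (D k)" if "U \<in> K j m" for U
      using D \<open>m \<le> j\<close> \<open>j \<le> k\<close> that by (rule d_bdd)
  qed
  \<comment> \<open>The rate is \<open>t \<circ> \<phi>\<close>: from \<open>t (\<phi> n)\<close> onwards \<open>\<phi>'\<close> is at least \<open>\<phi> n\<close>.\<close>
  obtain t where t: "\<And>j. \<phi>' (t j) = j" using \<phi>'(2) by (metis surjD)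
  have unbounded: "\<forall>j. \<exists>t. \<forall>n\<ge>t. j \<le> \<phi> n"
    using \<phi> by (metis monoD surjD)
  have "bounded_along_spread_pairs F (X \<times> Y) c (\<lambda>n. t (\<phi> n)) \<psi>"
    if \<psi>: "mono \<psi>" "surj \<psi>" "\<forall>n. \<psi> n \<le> \<phi> n" for \<psi> :: "nat \<Rightarrow> nat"
  proof -
    define I where "I m = {(n, n'). \<psi> n = m \<and> \<psi> n' = m \<and> t (\<phi> n) \<le> n'}" for m
    define E where "E m = (\<Union>(n, n')\<in>I m. C (\<phi> n) \<times> D (\<phi>' n'))" for m
    have sub: "E m \<subseteq> X \<times> Y" for m
      unfolding E_def split_def using C(1) D(1) by (intro UN_least Sigma_mono)
    have bdd: "cover_bounded (c m) (E m)" for m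
      unfolding E_def
    proof (rule cover_bounded_UN)
      have "I m \<subseteq> \<psi> -` {m} \<times> \<psi> -` {m}" by (auto simp: I_def)
      then show "finite (I m)"
        using finite_fibre_mono_surj[OF \<psi>(1,2), of m] by (simp add: finite_subset)
    next
      fix q assume "q \<in> I m"
      then obtain n n' where q: "q = (n, n')" "\<psi> n = m" "t (\<phi> n) \<le> n'" by (auto simp: I_def)
      have "m \<le> \<phi> n" using \<psi>(3) q(2) by auto
      moreover have "\<phi> n \<le> \<phi>' n'" using monoD[OF \<phi>'(1) q(3)] by (simp add: t)
      ultimately show "cover_bounded (c m) (case q of (n, n') \<Rightarrow> C (\<phi> n) \<times> D (\<phi>' n'))"
        using rectangle q(1) by simp
    qed
    have "\<exists>A\<in>F. \<forall>n\<in>A. \<forall>n'\<in>A. \<psi> n = \<psi> n' \<and> t (\<phi> n) \<le> n' \<longrightarrow> p \<in> E (\<psi> n)"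
      if p: "p \<in> X \<times> Y" for p
    proof
      obtain x y where xy: "p = (x, y)" "x \<in> X" "y \<in> Y" using p by blast
      let ?A = "{n. fst p \<in> C (\<phi> n)} \<inter> {n. snd p \<in> D (\<phi>' n)}"
      show "?A \<in> F"
        using free_ultrafilter_Int[OF F C_cov[OF xy(2)] D_cov[OF xy(3)]] xy(1) by simp
      show "\<forall>n\<in>?A. \<forall>n'\<in>?A. \<psi> n = \<psi> n' \<and> t (\<phi> n) \<le> n' \<longrightarrow> p \<in> E (\<psi> n)"
      proof (intro ballI impI)
        fix n n' assume "n \<in> ?A" "n' \<in> ?A" "\<psi> n = \<psi> n' \<and> t (\<phi> n) \<le> n'"
        then have "(n, n') \<in> I (\<psi> n)" "p \<in> C (\<phi> n) \<times> D (\<phi>' n')" using xy(1) by (simp_all add: I_def)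
        then show "p \<in> E (\<psi> n)" unfolding E_def by (intro UN_I[of "(n, n')"]) simp_all
      qed
    qed
    with sub bdd show ?thesis
      unfolding bounded_along_spread_pairs_def by (intro exI[of _ E] conjI allI ballI)
  qed
  with unbounded show ?thesis by (intro exI[of _ "\<lambda>n. t (\<phi> n)"] exI[of _ \<phi>]) simp
qed

lemma swap_image_right_product:
  fixes c :: "('a \<times> 'b) set set"
  assumes "c \<in> right_product \<mu> \<nu>"
  shows "(`) prod.swap ` c \<in> left_product \<nu> \<mu>"
proof -
  obtain u v where c: "c = {U \<times> V |U V. V \<in> v \<and> U \<in> u V}" and uv: "v \<in> \<nu>" "\<forall>V\<in>v. u V \<in> \<mu>"
    using assms unfolding right_product_def by (elim CollectE exE conjE)
  have image: "f ` {g U V |U V. P U V} = {f (g U V) |V U. P U V}"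
    for f :: "('a \<times> 'b) set \<Rightarrow> ('b \<times> 'a) set" and g :: "'a set \<Rightarrow> 'b set \<Rightarrow> ('a \<times> 'b) set" and P
    by auto
  have "(`) prod.swap ` c = {V \<times> U |V U. V \<in> v \<and> U \<in> u V}"
    unfolding c image product_swap ..
  then show ?thesis
    unfolding left_product_def using uv by (intro CollectI exI[of _ v] exI[of _ u] conjI)
qed

lemma right_product_bounded_along_spread_pairs:
  assumes F: "free_ultrafilter F"
    and X: "centered X \<mu>" "Menger (monotone_images F) X \<mu>" "\<mu> \<noteq> {}"
    and Y: "centered Y \<nu>" "Menger (monotone_images F) Y \<nu>"
    and c: "\<And>n. c n \<in> right_product \<mu> \<nu>"
  shows "\<exists>h s. (\<forall>j. \<exists>t. \<forall>n\<ge>t. j \<le> s n) \<and>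
    (\<forall>\<psi>. mono \<psi> \<and> surj \<psi> \<and> (\<forall>n. \<psi> n \<le> s n) \<longrightarrow> bounded_along_spread_pairs F (X \<times> Y) c h \<psi>)"
proof -
  have unswap: "bounded_along_spread_pairs F (X \<times> Y) c h \<psi>"
    if swapped: "bounded_along_spread_pairs F (Y \<times> X) (\<lambda>n. (`) prod.swap ` c n) h \<psi>"
    for h \<psi> :: "nat \<Rightarrow> nat"
  proof -
    obtain E where sub: "\<And>m. E m \<subseteq> Y \<times> X"
      and bdd: "\<And>m. cover_bounded ((`) prod.swap ` c m) (E m)"
      and cov: "\<forall>p\<in>Y \<times> X. \<exists>A\<in>F. \<forall>n\<in>A. \<forall>n'\<in>A. \<psi> n = \<psi> n' \<and> h n \<le> n' \<longrightarrow> p \<in> E (\<psi> n)"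
      using swapped unfolding bounded_along_spread_pairs_def by metis
    show ?thesis
      unfolding bounded_along_spread_pairs_def
    proof (intro exI[of _ "\<lambda>m. prod.swap ` E m"] conjI allI ballI)
      show "prod.swap ` E m \<subseteq> X \<times> Y" for m
        using image_mono[OF sub[of m], of prod.swap] by (simp only: product_swap)
      show "cover_bounded (c m) (prod.swap ` E m)" for m
        using cover_bounded_image[OF bdd[of m], of prod.swap] by (simp add: image_image)
      fix p assume "p \<in> X \<times> Y"
      then have "prod.swap p \<in> Y \<times> X" by (simp add: mem_Times_iff)
      with cov obtain A where A: "A \<in> F"
        "\<forall>n\<in>A. \<forall>n'\<in>A. \<psi> n = \<psi> n' \<and> h n \<le> n' \<longrightarrow> prod.swap p \<in> E (\<psi> n)"
        by metis
      have "p \<in> prod.swap ` B" if "prod.swap p \<in> B" for B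
        using imageI[OF that, of prod.swap] by simp
      with A show "\<exists>A\<in>F. \<forall>n\<in>A. \<forall>n'\<in>A. \<psi> n = \<psi> n' \<and> h n \<le> n' \<longrightarrow> p \<in> prod.swap ` E (\<psi> n)"
        by metis
    qed
  qed
  have "(`) prod.swap ` c n \<in> left_product \<nu> \<mu>" for n
    using c by (rule swap_image_right_product)
  then obtain h s where "(\<forall>j. \<exists>t. \<forall>n\<ge>t. j \<le> s n) \<and> (\<forall>\<psi>. mono \<psi> \<and> surj \<psi> \<and> (\<forall>n. \<psi> n \<le> s n) \<longrightarrow>
      bounded_along_spread_pairs F (Y \<times> X) (\<lambda>n. (`) prod.swap ` c n) h \<psi>)"
    using left_product_bounded_along_spread_pairs[OF F Y X, of "\<lambda>n. (`) prod.swap ` c n"]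
    by metis
  then show ?thesis by (intro exI[of _ h] exI[of _ s]) (simp add: unswap)
qed

section \<open>The semi-direct product\<close>

theorem theorem3p6:
  fixes F :: "nat set set"
    and X :: "'a set" and \<mu> :: "'a set set set"
    and Y :: "'b set" and \<nu> :: "'b set set set"
  assumes "free_ultrafilter F"
    and "\<not> (\<exists>U. Q_point U \<and> coherent F U)"
    and "multicovered X \<mu>" and "centered X \<mu>" and "Menger (monotone_images F) X \<mu>"
    and "multicovered Y \<nu>" and "centered Y \<nu>" and "Menger (monotone_images F) Y \<nu>"
  shows "Menger (monotone_images F) (X \<times> Y) (semidirect \<mu> \<nu>)"
  unfolding Menger_def
proof (intro allI impI)
  note F = assms(1)
  fix w :: "nat \<Rightarrow> ('a \<times> 'b) set set"
  assume "\<forall>n. w n \<in> semidirect \<mu> \<nu>"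
  then have "\<forall>n. \<exists>c d. w n = cover_meet c d \<and> c \<in> left_product \<mu> \<nu> \<and> d \<in> right_product \<mu> \<nu>"
    by (simp add: semidirect_def multicover_meet_def)
  then obtain c d where w: "\<And>n. w n = cover_meet (c n) (d n)"
    and c: "\<And>n. c n \<in> left_product \<mu> \<nu>" and d: "\<And>n. d n \<in> right_product \<mu> \<nu>"
    by metis
  have ne: "\<mu> \<noteq> {}" "\<nu> \<noteq> {}"
    using c[of 0] d[of 0] by (auto simp: left_product_def right_product_def)
  obtain h s where s: "\<forall>j. \<exists>t. \<forall>n\<ge>t. j \<le> s n"
    and left: "\<forall>\<psi>. mono \<psi> \<and> surj \<psi> \<and> (\<forall>n. \<psi> n \<le> s n) \<longrightarrow>
      bounded_along_spread_pairs F (X \<times> Y) c h \<psi>"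
    using left_product_bounded_along_spread_pairs[OF F assms(4,5,7,8) ne(2), of c, OF c]
    by (elim exE conjE)
  obtain h' s' where s': "\<forall>j. \<exists>t. \<forall>n\<ge>t. j \<le> s' n"
    and right: "\<forall>\<psi>. mono \<psi> \<and> surj \<psi> \<and> (\<forall>n. \<psi> n \<le> s' n) \<longrightarrow>
      bounded_along_spread_pairs F (X \<times> Y) d h' \<psi>"
    using right_product_bounded_along_spread_pairs[OF F assms(4,5) ne(1) assms(7,8), of d, OF d]
    by (elim exE conjE)
  have "\<forall>j. \<exists>t. \<forall>n\<ge>t. j \<le> min (s n) (s' n)"
  proof
    fix j
    obtain t t' where "\<forall>n\<ge>t. j \<le> s n" "\<forall>n\<ge>t'. j \<le> s' n" using s s' by metis
    then show "\<exists>t. \<forall>n\<ge>t. j \<le> min (s n) (s' n)" by (intro exI[of _ "max t t'"]) simp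
  qed
  then obtain \<psi> :: "nat \<Rightarrow> nat" where \<psi>: "mono \<psi>" "surj \<psi>"
    and slow: "\<And>n. \<psi> n \<le> min (s n) (s' n)"
    and pairs: "\<And>A. A \<in> F \<Longrightarrow>
      {m. \<exists>n\<in>A. \<exists>n'\<in>A. \<psi> n = m \<and> \<psi> n' = m \<and> max (h n) (h' n) \<le> n'} \<in> (`) \<psi> ` F"
    by (rule spread_pairs_in_fibres[OF F assms(2)]) (rule that)
  obtain E where E: "\<And>m. E m \<subseteq> X \<times> Y" "\<And>m. cover_bounded (c m) (E m)"
    and E_cov: "\<forall>p\<in>X \<times> Y. \<exists>A\<in>F. \<forall>n\<in>A. \<forall>n'\<in>A. \<psi> n = \<psi> n' \<and> h n \<le> n' \<longrightarrow> p \<in> E (\<psi> n)"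
    using left \<psi> slow unfolding bounded_along_spread_pairs_def by (metis min.boundedE)
  obtain E' where E': "\<And>m. E' m \<subseteq> X \<times> Y" "\<And>m. cover_bounded (d m) (E' m)"
    and E'_cov: "\<forall>p\<in>X \<times> Y. \<exists>A\<in>F. \<forall>n\<in>A. \<forall>n'\<in>A. \<psi> n = \<psi> n' \<and> h' n \<le> n' \<longrightarrow> p \<in> E' (\<psi> n)"
    using right \<psi> slow unfolding bounded_along_spread_pairs_def by (metis min.boundedE)
  define B where "B m = E m \<inter> E' m" for m
  have image: "free_ultrafilter ((`) \<psi> ` F)"
    using F \<psi> by (rule free_ultrafilter_monotone_image)
  have large: "{m. p \<in> B m} \<in> (`) \<psi> ` F" if p: "p \<in> X \<times> Y" for p
  proof -
    obtain A A' where A: "A \<in> F" "\<And>n n'. n \<in> A \<Longrightarrow> n' \<in> A \<Longrightarrow> \<psi> n = \<psi> n' \<Longrightarrow> h n \<le> n' \<Longrightarrow> p \<in> E (\<psi> n)"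
      and A': "A' \<in> F"
        "\<And>n n'. n \<in> A' \<Longrightarrow> n' \<in> A' \<Longrightarrow> \<psi> n = \<psi> n' \<Longrightarrow> h' n \<le> n' \<Longrightarrow> p \<in> E' (\<psi> n)"
      using E_cov E'_cov p by metis
    have "A \<inter> A' \<in> F" using F A(1) A'(1) by (rule free_ultrafilter_Int)
    from image pairs[OF this] show ?thesis
    proof (rule free_ultrafilter_mono, intro subsetI CollectI, elim CollectE bexE conjE)
      fix m n n' assume "n \<in> A \<inter> A'" "n' \<in> A \<inter> A'" "\<psi> n = m" "\<psi> n' = m" "max (h n) (h' n) \<le> n'"
      then show "p \<in> B m" using A(2)[of n n'] A'(2)[of n n'] by (simp add: B_def)
    qed
  qed
  have "(\<Union>m. B m) = X \<times> Y"
  proof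
    show "(\<Union>m. B m) \<subseteq> X \<times> Y" unfolding B_def using E(1) by (intro UN_least le_infI1)
    show "X \<times> Y \<subseteq> (\<Union>m. B m)"
    proof
      fix p assume "p \<in> X \<times> Y"
      then have "{m. p \<in> B m} \<noteq> {}" using large image unfolding free_ultrafilter_def by metis
      then show "p \<in> (\<Union>m. B m)" by blast
    qed
  qed
  moreover have "(`) \<psi> ` F \<in> monotone_images F"
    unfolding monotone_images_def using \<psi> by (intro CollectI exI[of _ \<psi>] conjI refl)
  ultimately have "semifilter_cover (monotone_images F) (X \<times> Y) B"
    unfolding semifilter_cover_def using large by (intro conjI bexI[of _ "(`) \<psi> ` F"] ballI)
  moreover have "B m \<subseteq> X \<times> Y" for m
    unfolding B_def using E(1) by (rule le_infI1)
  moreover have "cover_bounded (w m) (B m)" for m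
    unfolding B_def w using E(2) E'(2) by (rule cover_bounded_meet)
  ultimately show "\<exists>B. (\<forall>n. B n \<subseteq> X \<times> Y \<and> cover_bounded (w n) (B n)) \<and>
      semifilter_cover (monotone_images F) (X \<times> Y) B"
    by (intro exI[of _ B] conjI allI)
qed

end
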